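(* Let $n\ge 2$ and let the matrix $\mathbf{A}$ of a linear operator $A:\mathbb{R}^n\to\mathbb{R}^n$ be $\mathcal{J}$-sign-symmetric. Let its second compound matrix $\mathbf{A}^{(2)}$ also be $\mathcal{J}$-sign-symmetric. Let, in addition, $\rho(A)>0$. Then $\lambda_1=\rho(A)$ is a positive eigenvalue of $A$. Let $m\ge 1$ be the (algebraic) multiplicity of the eigenvalue $\rho(A)$. Then the eigenvalues of $A$ on the largest spectral circle $|\lambda|=\rho(A)$, counted with multiplicity, form $m$ sets, with an odd number $k_j\ge 1$ $(j=1,\ldots,m)$ of eigenvalues in the $j$-th set, such that the eigenvalues of the $j$-th set coincide with the $k_j$-th roots of $(\rho(A))^{k_j}$.
   Context: A real $N\times N$ matrix $\mathbf{M}=\{m_{ij}\}$ is called $\mathcal{J}$-sign-symmetric if there exists a subset $\mathcal{J}\subseteq\{1,\ldots,N\}$ such that: (a) $m_{ij}\le 0$ whenever exactly one of the indices $i,j$ belongs to $\mathcal{J}$; and (b) $m_{ij}<0$ implies that exactly one of $i,j$ belongs to $\mathcal{J}$. The term is existential: $\mathbf{A}$ and $\mathbf{A}^{(2)}$ each have their own set. The second compound matrix $\mathbf{A}^{(2)}$ is the $\binom{n}{2}\times\binom{n}{2}$ matrix of the minors of $\mathbf{A}$ formed by rows $i,j$ and columns $k,l$, where $1\le i<j\le n$, $1\le k<l\le n$, with the pairs numbered in lexicographic order. $\rho(A)$ is the spectral radius of $A$. *)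

theory Defs
  imports
    "Jordan_Normal_Form.Spectral_Radius"
    "Jordan_Normal_Form.DL_Submatrix"
    "HOL-Computational_Algebra.Computational_Algebra"
begin

text \<open>Indices of matrices run through \<open>0, \<dots>, N - 1\<close>.\<close>

definition J_sign_symmetric :: "real mat \<Rightarrow> bool" where
  "J_sign_symmetric M \<longleftrightarrow> square_mat M \<and>
     (\<exists>J. J \<subseteq> {..<dim_row M} \<and>
        (\<forall>i<dim_row M. \<forall>j<dim_row M.
           ((i \<in> J) \<noteq> (j \<in> J) \<longrightarrow> M $$ (i, j) \<le> 0) \<and>
           (M $$ (i, j) < 0 \<longrightarrow> (i \<in> J) \<noteq> (j \<in> J))))"

definition lex_pairs :: "nat \<Rightarrow> (nat \<times> nat) list" where
  "lex_pairs n = [(i, j). i \<leftarrow> [0..<n], j \<leftarrow> [Suc i..<n]]"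

lemma set_lex_pairs: "set (lex_pairs n) = {(i, j). i < j \<and> j < n}"
  by (fastforce simp: lex_pairs_def)

lemma sorted_wrt_concat_map:
  assumes "sorted_wrt Q xs"
    and "\<And>x. x \<in> set xs \<Longrightarrow> sorted_wrt P (f x)"
    and "\<And>x y a b. Q x y \<Longrightarrow> a \<in> set (f x) \<Longrightarrow> b \<in> set (f y) \<Longrightarrow> P a b"
  shows "sorted_wrt P (concat (map f xs))"
  using assms by (induction xs) (auto simp: sorted_wrt_append)

lemma sorted_lex_pairs:
  "sorted_wrt (\<lambda>(i, j) (k, l). i < k \<or> i = k \<and> j < l) (lex_pairs n)"
  unfolding lex_pairs_def
  by (rule sorted_wrt_concat_map[where Q = "(<)"])
     (auto simp: sorted_wrt_map)

lemma length_lex_pairs: "length (lex_pairs n) = n choose 2"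
proof -
  have "length (lex_pairs n) = (\<Sum>i<n. n - Suc i)"
    by (simp add: lex_pairs_def length_concat comp_def interv_sum_list_conv_sum_set_nat
        atLeast0LessThan)
  also have "\<dots> = \<Sum>{..<n}"
    by (rule sum.nat_diff_reindex)
  also have "\<dots> = n choose 2"
    using gauss_sum_nat[of "n - 1"]
    by (cases n) (auto simp: choose_two lessThan_Suc_atMost atMost_atLeast0 mult.commute)
  finally show ?thesis .
qed

definition second_compound :: "'a :: comm_ring_1 mat \<Rightarrow> 'a mat" where
  "second_compound A =
     mat (dim_row A choose 2) (dim_col A choose 2)
       (\<lambda>(r, c). let (i, j) = lex_pairs (dim_row A) ! r; (k, l) = lex_pairs (dim_col A) ! c
                  in det (submatrix A {i, j} {k, l}))"

text \<open>The eigenvalues of a real operator are taken over the complex numbers.\<close>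

definition real_spectral_radius :: "real mat \<Rightarrow> real" where
  "real_spectral_radius A = spectral_radius (map_mat complex_of_real A)"

definition eigenvalue_mset :: "real mat \<Rightarrow> complex multiset" where
  "eigenvalue_mset A = proots (char_poly (map_mat complex_of_real A))"

definition peripheral_mset :: "real mat \<Rightarrow> complex multiset" where
  "peripheral_mset A = {# z \<in># eigenvalue_mset A. cmod z = real_spectral_radius A #}"

end

theory Submission
  imports Defs "HOL-Real_Asymp.Real_Asymp"
begin

text \<open>Up to a diagonal signature similarity and the factor \<open>\<rho>\<close>, \<open>A\<close> is a nonnegative matrix \<open>a\<close>
  of spectral radius 1, and the sign condition on the second compound says that
  \<open>s\<^sub>i\<^sub>j s\<^sub>k\<^sub>l (a\<^sub>i\<^sub>k a\<^sub>j\<^sub>l - a\<^sub>i\<^sub>l a\<^sub>j\<^sub>k) \<ge> 0\<close> for suitable signs \<open>s\<close>. This condition passes to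
  principal submatrices, so by splitting off invariant index sets one may assume \<open>a\<close> irreducible.
  If \<open>\<lambda>\<close> is then a peripheral eigenvalue with eigenvector \<open>z\<close>, then \<open>|z|\<close> is a positive
  fixed vector of \<open>a\<close>, and equality in the triangle inequality shows that \<open>a\<close> is diagonally
  similar to \<open>\<lambda> a\<close>. Hence the spectrum with multiplicities is invariant under multiplication by
  \<open>\<lambda>\<close>, so the peripheral spectrum is a multiple of the set of \<open>h\<close>-th roots of unity for some \<open>h\<close>
  (that the multiple is 1 is irrelevant). By the Cauchy--Binet formula the sign condition also passes
  to powers, so that \<open>(a\<^sup>p)\<^sub>i\<^sub>k (a\<^sup>p)\<^sub>k\<^sub>i \<le> (a\<^sup>p)\<^sub>i\<^sub>i (a\<^sup>p)\<^sub>k\<^sub>k\<close>: if \<open>a\<^sup>p\<close> has zero diagonal,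
  so has \<open>a\<^bsup>2p\<^esup>\<close>. For even \<open>h\<close> and \<open>p\<close> an odd multiple of \<open>h / 2\<close> this contradicts the
  asymptotics of the traces of powers.\<close>

section \<open>Matrices indexed by lists\<close>

text \<open>Lists label rows and columns, so passing to a subset of the indices or reordering them
  changes only the list and never renumbers entries.\<close>

definition fun_mat :: "('a \<Rightarrow> 'b \<Rightarrow> 'c) \<Rightarrow> 'a list \<Rightarrow> 'b list \<Rightarrow> 'c mat" where
  "fun_mat f xs ys = mat (length xs) (length ys) (\<lambda>(i, j). f (xs ! i) (ys ! j))"

lemma fun_mat_carrier [simp]: "fun_mat f xs ys \<in> carrier_mat (length xs) (length ys)"
  by (simp add: fun_mat_def)

lemma dim_fun_mat [simp]:
  "dim_row (fun_mat f xs ys) = length xs" "dim_col (fun_mat f xs ys) = length ys"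
  by (simp_all add: fun_mat_def)

lemma fun_mat_cong:
  assumes "\<And>i j. i \<in> set xs \<Longrightarrow> j \<in> set ys \<Longrightarrow> f i j = g i j"
  shows "fun_mat f xs ys = fun_mat g xs ys"
  using assms by (auto simp: fun_mat_def intro!: eq_matI)

lemma sum_nth_distinct:
  assumes "distinct xs"
  shows "(\<Sum>i<length xs. f (xs ! i)) = sum f (set xs)"
  using assms by (simp add: sum.distinct_set_conv_list sum_list_sum_nth atLeast0LessThan)

lemma fun_mat_mult:
  assumes "distinct ys"
  shows "fun_mat f xs ys * fun_mat g ys zs = fun_mat (\<lambda>i k. \<Sum>j\<in>set ys. f i j * g j k) xs zs"
  by (auto simp: fun_mat_def scalar_prod_def atLeast0LessThan
      sum_nth_distinct[OF assms, symmetric] intro!: eq_matI)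

lemma fun_mat_one:
  assumes "distinct xs"
  shows "fun_mat (\<lambda>i j. if i = j then 1 else 0) xs xs = 1\<^sub>m (length xs)"
  using assms by (auto simp: fun_mat_def nth_eq_iff_index_eq intro!: eq_matI)

section \<open>Similarity, block triangular form and the spectrum as a multiset\<close>

text \<open>One conjugating matrix, which puts \<open>d\<close> where labels of \<open>xs\<close>
  and \<open>ys\<close> agree, performs a diagonal similarity and a reordering at once. It serves
  for signatures, phases and, with \<open>d = 1\<close>, permutations into block form.\<close>

lemma char_poly_fun_mat_eqI:
  fixes a b :: "'a \<Rightarrow> 'a \<Rightarrow> 'b :: field"
  assumes xs: "distinct xs" and ys: "distinct ys" and set: "set xs = set ys"
    and d: "\<And>i. i \<in> set xs \<Longrightarrow> d i \<noteq> 0"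
    and ab: "\<And>i j. i \<in> set xs \<Longrightarrow> j \<in> set xs \<Longrightarrow> a i j * d j = d i * b i j"
  shows "char_poly (fun_mat a xs xs) = char_poly (fun_mat b ys ys)"
proof -
  have len: "length ys = length xs"
    using distinct_card[OF xs] distinct_card[OF ys] set by simp
  let ?P = "fun_mat (\<lambda>i j. if i = j then d i else 0) xs ys"
  let ?Q = "fun_mat (\<lambda>i j. if i = j then inverse (d i) else 0) ys xs"
  have carr: "{fun_mat a xs xs, fun_mat b ys ys, ?P, ?Q} \<subseteq> carrier_mat (length xs) (length xs)"
    using fun_mat_carrier[of _ xs ys] fun_mat_carrier[of _ ys xs] fun_mat_carrier[of _ ys ys]
    by (auto simp: len)
  have PQ: "?P * ?Q = 1\<^sub>m (length xs)"
    unfolding fun_mat_mult[OF ys] fun_mat_one[OF xs, symmetric]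
    by (rule fun_mat_cong) (use d set in \<open>auto simp: if_distrib[of "\<lambda>x. x * _"] cong: if_cong\<close>)
  have QP: "?Q * ?P = 1\<^sub>m (length xs)"
    unfolding fun_mat_mult[OF xs] fun_mat_one[OF ys, symmetric] len[symmetric]
    by (rule fun_mat_cong) (use d set in \<open>auto simp: if_distrib[of "\<lambda>x. x * _"] cong: if_cong\<close>)
  have "fun_mat a xs xs = ?P * fun_mat b ys ys * ?Q"
    unfolding fun_mat_mult[OF ys]
  proof (rule fun_mat_cong)
    fix i j assume ij: "i \<in> set xs" "j \<in> set xs"
    have "(\<Sum>k\<in>set ys. (\<Sum>l\<in>set ys. (if i = l then d i else 0) * b l k) *
            (if k = j then inverse (d k) else 0)) = d i * b i j * inverse (d j)"
      using ij set by (simp add: if_distrib[of "\<lambda>x. x * _"] if_distrib[of "\<lambda>x. _ * x"] cong: if_cong)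
    also have "\<dots> = a i j"
      using ab[OF ij] d[OF ij(2)] by (simp add: field_simps)
    finally show "a i j = (\<Sum>k\<in>set ys. (\<Sum>l\<in>set ys. (if i = l then d i else 0) * b l k) *
            (if k = j then inverse (d k) else 0))" ..
  qed
  then have "similar_mat (fun_mat a xs xs) (fun_mat b ys ys)"
    using similar_matI[OF carr PQ QP] by blast
  then show ?thesis
    by (rule char_poly_similar)
qed

lemma char_poly_fun_mat_append:
  fixes a :: "'a \<Rightarrow> 'a \<Rightarrow> 'b :: idom"
  assumes "\<And>i j. i \<in> set ys \<Longrightarrow> j \<in> set xs \<Longrightarrow> a i j = 0"
  shows "char_poly (fun_mat a (xs @ ys) (xs @ ys)) =
    char_poly (fun_mat a xs xs) * char_poly (fun_mat a ys ys)"
proof -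
  let ?C = "\<lambda>xs. char_poly_matrix (fun_mat a xs xs)"
  let ?n = "length xs" and ?m = "length ys"
  have "?C (xs @ ys) = four_block_mat (?C xs) (mat ?n ?m (\<lambda>(i, j). [:- a (xs ! i) (ys ! j):]))
      (0\<^sub>m ?m ?n) (?C ys)"
    using assms
    by (intro eq_matI) (auto simp: char_poly_matrix_def fun_mat_def nth_append)
  then show ?thesis
    unfolding char_poly_def
    by (simp add: det_four_block_mat_lower_left_zero[OF char_poly_matrix_closed[OF fun_mat_carrier]
          _ refl char_poly_matrix_closed[OF fun_mat_carrier]])
qed

definition fun_spec :: "('a \<Rightarrow> 'a \<Rightarrow> complex) \<Rightarrow> 'a list \<Rightarrow> complex multiset" where
  "fun_spec a xs = proots (char_poly (fun_mat a xs xs))"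

lemma fun_spec_eqI:
  assumes "distinct xs" "distinct ys" "set xs = set ys"
    and "\<And>i. i \<in> set xs \<Longrightarrow> d i \<noteq> 0"
    and "\<And>i j. i \<in> set xs \<Longrightarrow> j \<in> set xs \<Longrightarrow> a i j * d j = d i * b i j"
  shows "fun_spec a xs = fun_spec b ys"
  unfolding fun_spec_def
  by (rule arg_cong[where f = proots], rule char_poly_fun_mat_eqI[of xs ys d]) (use assms in auto)

lemma char_poly_fun_mat_nonzero:
  fixes a :: "'a \<Rightarrow> 'a \<Rightarrow> 'b :: idom"
  shows "char_poly (fun_mat a xs xs) \<noteq> 0"
  using degree_monic_char_poly[OF fun_mat_carrier[of a xs xs]] by auto

lemma fun_spec_append:
  assumes "\<And>i j. i \<in> set ys \<Longrightarrow> j \<in> set xs \<Longrightarrow> a i j = 0"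
  shows "fun_spec a (xs @ ys) = fun_spec a xs + fun_spec a ys"
  unfolding fun_spec_def
  by (subst char_poly_fun_mat_append) (auto simp: assms proots_mult char_poly_fun_mat_nonzero)

lemma eigenvalue_fun_mat_iff:
  fixes a :: "'a \<Rightarrow> 'a \<Rightarrow> 'b :: field"
  assumes "distinct xs"
  shows "eigenvalue (fun_mat a xs xs) e \<longleftrightarrow>
    (\<exists>v. (\<exists>i\<in>set xs. v i \<noteq> 0) \<and> (\<forall>i\<in>set xs. (\<Sum>j\<in>set xs. a i j * v j) = e * v i))"
proof
  assume "eigenvalue (fun_mat a xs xs) e"
  then obtain v where v: "v \<in> carrier_vec (length xs)" "v \<noteq> 0\<^sub>v (length xs)"
    "fun_mat a xs xs *\<^sub>v v = e \<cdot>\<^sub>v v"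
    by (auto simp: eigenvalue_def eigenvector_def)
  define w where "w x = v $ (THE i. i < length xs \<and> xs ! i = x)" for x
  have w: "w (xs ! i) = v $ i" if "i < length xs" for i
    unfolding w_def using that assms
    by (intro arg_cong[where f = "($) v"] the_equality) (auto simp: nth_eq_iff_index_eq)
  obtain i where i: "i < length xs" "v $ i \<noteq> 0"
    using v by (auto simp: vec_eq_iff)
  have "(\<Sum>j\<in>set xs. a (xs ! i) j * w j) = e * w (xs ! i)" if "i < length xs" for i
  proof -
    have "(fun_mat a xs xs *\<^sub>v v) $ i = e * v $ i"
      using that v by simp
    then show ?thesis
      using that v
      by (simp add: fun_mat_def scalar_prod_def w atLeast0LessThan flip: sum_nth_distinct[OF assms])
  qed
  then show "\<exists>v. (\<exists>i\<in>set xs. v i \<noteq> 0) \<and> (\<forall>i\<in>set xs. (\<Sum>j\<in>set xs. a i j * v j) = e * v i)"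
    using i w by (intro exI[of _ w]) (auto simp: in_set_conv_nth intro!: bexI[of _ "xs ! i"])
next
  assume "\<exists>v. (\<exists>i\<in>set xs. v i \<noteq> 0) \<and> (\<forall>i\<in>set xs. (\<Sum>j\<in>set xs. a i j * v j) = e * v i)"
  then obtain v where v: "\<exists>i\<in>set xs. v i \<noteq> 0" "\<And>i. i \<in> set xs \<Longrightarrow> (\<Sum>j\<in>set xs. a i j * v j) = e * v i"
    by blast
  have "eigenvector (fun_mat a xs xs) (vec (length xs) (\<lambda>i. v (xs ! i))) e"
    using v
    by (auto simp: eigenvector_def vec_eq_iff in_set_conv_nth fun_mat_def scalar_prod_def
        atLeast0LessThan simp flip: sum_nth_distinct[OF assms])
  then show "eigenvalue (fun_mat a xs xs) e"
    by (auto simp: eigenvalue_def)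
qed

lemma in_fun_spec_iff: "z \<in># fun_spec a xs \<longleftrightarrow> eigenvalue (fun_mat a xs xs) z"
  using eigenvalue_root_char_poly[OF fun_mat_carrier[of a xs xs], of z]
  by (simp add: fun_spec_def char_poly_fun_mat_nonzero)

section \<open>Powers, triangularization and traces\<close>

primrec fun_pow :: "('a \<Rightarrow> 'a \<Rightarrow> 'b :: comm_semiring_1) \<Rightarrow> 'a set \<Rightarrow> nat \<Rightarrow> 'a \<Rightarrow> 'a \<Rightarrow> 'b" where
  "fun_pow a S 0 = (\<lambda>i j. if i = j then 1 else 0)"
| "fun_pow a S (Suc p) = (\<lambda>i j. \<Sum>k\<in>S. fun_pow a S p i k * a k j)"

lemma fun_mat_pow:
  assumes "distinct xs"
  shows "fun_mat a xs xs ^\<^sub>m p = fun_mat (fun_pow a (set xs) p) xs xs"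
  by (induction p) (simp_all add: fun_mat_one fun_mat_mult assms)

lemma fun_pow_add:
  assumes "finite S" "j \<in> S"
  shows "fun_pow a S (p + q) i j = (\<Sum>k\<in>S. fun_pow a S p i k * fun_pow a S q k j)"
  using assms(2)
proof (induction q arbitrary: j)
  case 0
  with assms(1) show ?case
    by (simp add: if_distrib[of "\<lambda>x. _ * x"] cong: if_cong)
next
  case (Suc q)
  then show ?case
    by (auto simp: sum_distrib_left sum_distrib_right mult.assoc intro: sum.swap)
qed

lemma upper_triangular_mult:
  fixes A B :: "'a :: semiring_0 mat"
  assumes A: "A \<in> carrier_mat n n" "upper_triangular A"
    and B: "B \<in> carrier_mat n n" "upper_triangular B"
  shows "upper_triangular (A * B)"
    and "i < n \<Longrightarrow> (A * B) $$ (i, i) = A $$ (i, i) * B $$ (i, i)"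
proof -
  have AB: "A $$ (i, k) * B $$ (k, j) = 0" if "i < n" "k < n" "k < i \<or> j < k" for i j k
    using that upper_triangularD[OF A(2), of k i] upper_triangularD[OF B(2), of j k] A(1) B(1)
    by auto
  show "upper_triangular (A * B)"
  proof (rule upper_triangularI)
    fix i j assume ij: "j < i" "i < dim_row (A * B)"
    have "(A * B) $$ (i, j) = (\<Sum>k = 0..<n. A $$ (i, k) * B $$ (k, j))"
      using ij A(1) B(1) by (simp add: scalar_prod_def)
    also have "\<dots> = 0"
      using ij A(1) by (intro sum.neutral ballI AB) auto
    finally show "(A * B) $$ (i, j) = 0" .
  qed
  show "(A * B) $$ (i, i) = A $$ (i, i) * B $$ (i, i)" if i: "i < n"
  proof -
    have "(A * B) $$ (i, i) = (\<Sum>k = 0..<n. A $$ (i, k) * B $$ (k, i))"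
      using i A(1) B(1) by (simp add: scalar_prod_def)
    also have "\<dots> = (\<Sum>k\<in>{i}. A $$ (i, k) * B $$ (k, i))"
      using i by (intro sum.mono_neutral_right ballI AB) auto
    finally show ?thesis by simp
  qed
qed

lemma upper_triangular_pow:
  fixes A :: "'a :: comm_semiring_1 mat"
  assumes A: "A \<in> carrier_mat n n" "upper_triangular A"
  shows "upper_triangular (A ^\<^sub>m p) \<and> (\<forall>i<n. (A ^\<^sub>m p) $$ (i, i) = A $$ (i, i) ^ p)"
proof (induction p)
  case 0
  show ?case
    using A by simp
next
  case (Suc p)
  then show ?case
    using upper_triangular_mult[of "A ^\<^sub>m p" n A] A by (simp add: mult.commute)
qed

lemma trace_mult_commute:
  fixes A B :: "'a :: comm_semiring_0 mat"
  assumes "A \<in> carrier_mat n n" "B \<in> carrier_mat n n"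
  shows "(\<Sum>i<n. (A * B) $$ (i, i)) = (\<Sum>i<n. (B * A) $$ (i, i))"
proof -
  have "(\<Sum>i<n. (A * B) $$ (i, i)) = (\<Sum>i<n. \<Sum>j<n. A $$ (i, j) * B $$ (j, i))"
    using assms by (simp add: scalar_prod_def atLeast0LessThan)
  also have "\<dots> = (\<Sum>j<n. \<Sum>i<n. B $$ (j, i) * A $$ (i, j))"
    by (subst sum.swap) (simp add: mult.commute)
  also have "\<dots> = (\<Sum>i<n. (B * A) $$ (i, i))"
    using assms by (simp add: scalar_prod_def atLeast0LessThan)
  finally show ?thesis .
qed

lemma proots_linear_factors:
  fixes as :: "'a :: idom list"
  shows "proots (\<Prod>a\<leftarrow>as. [:- a, 1:]) = mset as"
proof (induction as)
  case (Cons a as)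
  have "(\<Prod>a\<leftarrow>as. [:- a, 1:]) \<noteq> 0"
    by (auto simp: prod_list_zero_iff)
  then show ?case
    using Cons by (simp add: proots_mult del: mult_pCons_left)
qed simp

lemma proots_char_poly_upper_triangular:
  fixes B :: "'a :: idom mat"
  assumes "B \<in> carrier_mat n n" "upper_triangular B"
  shows "proots (char_poly B) = image_mset (\<lambda>i. B $$ (i, i)) (mset [0..<n])"
  unfolding char_poly_upper_triangular[OF assms] proots_linear_factors
  using assms(1) by (simp add: diag_mat_def)

lemma complex_upper_triangularization:
  fixes A :: "complex mat"
  assumes "A \<in> carrier_mat n n"
  obtains B P Q where "B \<in> carrier_mat n n" "upper_triangular B" "similar_mat_wit A B P Q"
  using char_poly_factorized[OF assms] schur_decomposition_exists[OF assms] similar_mat_def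
  by metis

lemma proots_char_poly_smult:
  fixes A :: "complex mat"
  assumes A: "A \<in> carrier_mat n n"
  shows "proots (char_poly (c \<cdot>\<^sub>m A)) = image_mset ((*) c) (proots (char_poly A))"
proof -
  obtain B P Q where B: "B \<in> carrier_mat n n" "upper_triangular B" "similar_mat_wit A B P Q"
    using complex_upper_triangularization[OF A] .
  then have sim: "similar_mat A B"
    by (auto simp: similar_mat_def)
  have "upper_triangular (c \<cdot>\<^sub>m B)"
    using B(1,2) by (intro upper_triangularI) (auto dest: upper_triangularD)
  then have "proots (char_poly (c \<cdot>\<^sub>m B)) = image_mset (\<lambda>i. c * B $$ (i, i)) (mset [0..<n])"
    using proots_char_poly_upper_triangular[of "c \<cdot>\<^sub>m B" n] B(1)
    by (auto intro!: image_mset_cong)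
  then show ?thesis
    unfolding char_poly_similar[OF sim] char_poly_similar[OF similar_mat_smult[OF sim]]
      proots_char_poly_upper_triangular[OF B(1,2)]
    by (simp add: multiset.map_comp comp_def)
qed

text \<open>With \<open>A\<close> triangularized as \<open>B\<close>, the diagonal of
  \<open>B ^\<^sub>m p\<close> holds the powers of the eigenvalues with multiplicity, and cyclicity
  of the trace removes the conjugation.\<close>

lemma trace_pow_eq_sum_proots:
  fixes A :: "complex mat"
  assumes A: "A \<in> carrier_mat n n"
  shows "(\<Sum>i<n. (A ^\<^sub>m p) $$ (i, i)) = (\<Sum>z\<in>#proots (char_poly A). z ^ p)"
proof -
  obtain B P Q where B: "B \<in> carrier_mat n n" "upper_triangular B" "similar_mat_wit A B P Q"
    using complex_upper_triangularization[OF A] .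
  then have sim: "similar_mat A B"
    by (auto simp: similar_mat_def)
  note wit = similar_mat_witD2[OF A B(3)]
  have Bp: "B ^\<^sub>m p \<in> carrier_mat n n"
    using B(1) by simp
  have "A ^\<^sub>m p = P * (B ^\<^sub>m p * Q)"
    using similar_mat_wit_pow_id[OF B(3)] wit Bp by (simp add: assoc_mult_mat[of _ n n _ n _ n])
  moreover have "(\<Sum>i<n. (P * (B ^\<^sub>m p * Q)) $$ (i, i)) = (\<Sum>i<n. (B ^\<^sub>m p * Q * P) $$ (i, i))"
    by (rule trace_mult_commute) (use wit Bp in auto)
  ultimately have "(\<Sum>i<n. (A ^\<^sub>m p) $$ (i, i)) = (\<Sum>i<n. (B ^\<^sub>m p * Q * P) $$ (i, i))"
    by (simp only:)
  also have "B ^\<^sub>m p * Q * P = B ^\<^sub>m p"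
    using wit Bp by (simp add: assoc_mult_mat[of _ n n _ n _ n])
  also have "(\<Sum>i<n. (B ^\<^sub>m p) $$ (i, i)) = (\<Sum>i<n. B $$ (i, i) ^ p)"
    using upper_triangular_pow[OF B(1,2)] by simp
  also have "\<dots> = (\<Sum>z\<in>#proots (char_poly A). z ^ p)"
    unfolding char_poly_similar[OF sim] proots_char_poly_upper_triangular[OF B(1,2)]
    by (simp add: multiset.map_comp comp_def sum_unfold_sum_mset lessThan_atLeast0 mset_upt)
  finally show ?thesis .
qed

lemma fun_spec_smult: "fun_spec (\<lambda>i j. c * a i j) xs = image_mset ((*) c) (fun_spec a xs)"
proof -
  have "fun_mat (\<lambda>i j. c * a i j) xs xs = c \<cdot>\<^sub>m fun_mat a xs xs"
    by (auto simp: fun_mat_def)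
  then show ?thesis
    using proots_char_poly_smult[OF fun_mat_carrier] by (simp add: fun_spec_def)
qed

lemma trace_fun_pow:
  assumes "distinct xs"
  shows "(\<Sum>i\<in>set xs. fun_pow a (set xs) p i i) = (\<Sum>z\<in>#fun_spec a xs. z ^ p)"
  using trace_pow_eq_sum_proots[OF fun_mat_carrier[of a xs xs], of p]
  by (simp add: fun_mat_pow[OF assms] fun_spec_def)
    (simp add: fun_mat_def flip: sum_nth_distinct[OF assms])

section \<open>Growth of powers of nonnegative matrices\<close>

lemma fun_pow_of_real:
  "fun_pow (\<lambda>i j. of_real (a i j)) S p i j = (of_real (fun_pow a S p i j) :: complex)"
  by (induction p arbitrary: j) auto

lemma fun_pow_nonneg:
  fixes a :: "'a \<Rightarrow> 'a \<Rightarrow> real"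
  assumes "\<And>i j. i \<in> S \<Longrightarrow> j \<in> S \<Longrightarrow> 0 \<le> a i j" and "i \<in> S" "j \<in> S"
  shows "0 \<le> fun_pow a S p i j"
  using assms(3) by (induction p arbitrary: j) (auto intro!: sum_nonneg mult_nonneg_nonneg assms)

lemma fun_pow_mult_vec_ge:
  fixes a :: "'a \<Rightarrow> 'a \<Rightarrow> real"
  assumes S: "finite S" and a: "\<And>i j. i \<in> S \<Longrightarrow> j \<in> S \<Longrightarrow> 0 \<le> a i j"
    and r: "0 \<le> r" and w: "\<And>i. i \<in> S \<Longrightarrow> r * w i \<le> (\<Sum>j\<in>S. a i j * w j)"
    and i: "i \<in> S"
  shows "r ^ p * w i \<le> (\<Sum>j\<in>S. fun_pow a S p i j * w j)"
proof (induction p)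
  case 0
  show ?case
    using S i by (simp add: if_distrib[of "\<lambda>x. x * _"] cong: if_cong)
next
  case (Suc p)
  have "r ^ Suc p * w i \<le> r * (\<Sum>j\<in>S. fun_pow a S p i j * w j)"
    using mult_left_mono[OF Suc r] by (simp add: mult_ac)
  also have "\<dots> = (\<Sum>j\<in>S. fun_pow a S p i j * (r * w j))"
    by (simp add: sum_distrib_left mult_ac)
  also have "\<dots> \<le> (\<Sum>j\<in>S. fun_pow a S p i j * (\<Sum>k\<in>S. a j k * w k))"
    using fun_pow_nonneg[OF a i] w by (intro sum_mono mult_left_mono) auto
  also have "\<dots> = (\<Sum>k\<in>S. fun_pow a S (Suc p) i k * w k)"
    by (simp add: sum_distrib_left sum_distrib_right mult.assoc) (rule sum.swap)
  finally show ?case .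
qed

lemma polynomial_less_exponential:
  fixes r C1 C2 :: real
  assumes "1 < r"
  obtains k where "C1 + C2 * real k ^ d < r ^ k"
proof -
  have "(\<lambda>k. (C1 + C2 * real k ^ d) / r ^ k) \<longlonglongrightarrow> 0"
    using assms by real_asymp
  then have "eventually (\<lambda>k. (C1 + C2 * real k ^ d) / r ^ k < 1) sequentially"
    by (rule order_tendstoD) simp
  then obtain k where "(C1 + C2 * real k ^ d) / r ^ k < 1"
    by (auto simp: eventually_sequentially)
  with assms have "C1 + C2 * real k ^ d < r ^ k"
    by (simp add: field_simps)
  then show thesis ..
qed

text \<open>If \<open>r > 1\<close>, the k-th power of \<open>a\<close> applied to \<open>w\<close>
  grows at \<open>i\<close> at least like \<open>r ^ k\<close>, whereas spectral radius at most 1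
  allows only polynomial growth.\<close>

lemma supervector_ratio_le_1:
  fixes a :: "'a \<Rightarrow> 'a \<Rightarrow> real"
  assumes xs: "distinct xs"
    and a: "\<And>i j. i \<in> set xs \<Longrightarrow> j \<in> set xs \<Longrightarrow> 0 \<le> a i j"
    and spec: "\<And>z. z \<in># fun_spec (\<lambda>i j. complex_of_real (a i j)) xs \<Longrightarrow> cmod z \<le> 1"
    and r: "0 \<le> r" and w: "\<And>i. i \<in> set xs \<Longrightarrow> r * w i \<le> (\<Sum>j\<in>set xs. a i j * w j)"
    and w_nonneg: "\<And>i. i \<in> set xs \<Longrightarrow> 0 \<le> w i" and i: "i \<in> set xs" "w i > 0"
  shows "r \<le> 1"
proof (rule ccontr)
  assume "\<not> r \<le> 1"
  let ?n = "length xs"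
  let ?M = "fun_mat (\<lambda>i j. complex_of_real (a i j)) xs xs"
  have n: "?n > 0"
    using i by (auto simp: length_pos_if_in_set)
  have "spectral_radius ?M \<in> cmod ` spectrum ?M"
    by (rule spectral_radius_mem_max[OF fun_mat_carrier n])
  then have "spectral_radius ?M \<le> 1"
    using spec by (auto simp: spectrum_def in_fun_spec_iff)
  \<comment> \<open>Powers of Jordan blocks with eigenvalues of modulus at most 1 grow at most
    polynomially in \<open>k\<close>.\<close>
  then obtain c1 c2 where c: "norm_bound (?M ^\<^sub>m k) (c1 + c2 * real k ^ (?n - 1))" for k
    using spectral_radius_jnf_norm_bound_le_1_upper_triangular[OF fun_mat_carrier] by blast
  have bound: "fun_pow a (set xs) k i j \<le> c1 + c2 * real k ^ (?n - 1)" if "j \<in> set xs" for j k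
  proof -
    obtain i' j' where "i' < ?n" "xs ! i' = i" "j' < ?n" "xs ! j' = j"
      using \<open>i \<in> set xs\<close> \<open>j \<in> set xs\<close> by (metis in_set_conv_nth)
    then have "cmod (fun_pow (\<lambda>i j. complex_of_real (a i j)) (set xs) k i j) \<le> c1 + c2 * real k ^ (?n - 1)"
      using c[of k] unfolding norm_bound_def fun_mat_pow[OF xs] by (auto simp: fun_mat_def)
    then show ?thesis
      by (simp add: fun_pow_of_real)
  qed
  let ?W = "sum w (set xs)"
  obtain k where k: "c1 * ?W / w i + c2 * ?W / w i * real k ^ (?n - 1) < r ^ k"
    using polynomial_less_exponential \<open>\<not> r \<le> 1\<close> by (metis not_le)
  have "r ^ k * w i \<le> (\<Sum>j\<in>set xs. fun_pow a (set xs) k i j * w j)"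
    by (rule fun_pow_mult_vec_ge) (use a r w i in auto)
  also have "\<dots> \<le> (\<Sum>j\<in>set xs. (c1 + c2 * real k ^ (?n - 1)) * w j)"
    by (intro sum_mono mult_right_mono bound w_nonneg)
  also have "\<dots> = (c1 + c2 * real k ^ (?n - 1)) * ?W"
    by (rule sum_distrib_left [symmetric])
  also have "\<dots> = (c1 * ?W / w i + c2 * ?W / w i * real k ^ (?n - 1)) * w i"
    using i(2) by (simp add: field_simps)
  also have "\<dots> < r ^ k * w i"
    using k i(2) by simp
  finally show False by simp
qed

section \<open>Sign-symmetric minors of order two\<close>

abbreviation minor2 :: "('a \<Rightarrow> 'b \<Rightarrow> 'c :: ring) \<Rightarrow> 'a \<Rightarrow> 'a \<Rightarrow> 'b \<Rightarrow> 'b \<Rightarrow> 'c" where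
  "minor2 a i j k l \<equiv> a i k * a j l - a i l * a j k"

text \<open>The Cauchy-Binet formula for order two. Summation over all \<open>m\<close>,
  \<open>n\<close> avoids an order on the indices and counts each product of minors twice, hence the
  factor 2.\<close>

lemma minor2_fun_pow_Suc:
  fixes a :: "'a \<Rightarrow> 'a \<Rightarrow> 'b :: comm_ring_1"
  shows "2 * minor2 (fun_pow a S (Suc p)) i j k l =
    (\<Sum>m\<in>S. \<Sum>n\<in>S. minor2 (fun_pow a S p) i j m n * minor2 a m n k l)"
proof -
  define P where "P = fun_pow a S p"
  define X where "X m n = P i m * P j n * (a m k * a n l) - P i m * P j n * (a m l * a n k)" for m n
  have "minor2 (fun_pow a S (Suc p)) i j k l = (\<Sum>m\<in>S. \<Sum>n\<in>S. X m n)"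
    unfolding X_def sum_subtractf fun_pow.simps P_def [symmetric] sum_product
    by (intro arg_cong2[where f = "(-)"] sum.cong refl) (simp_all only: mult_ac)
  moreover have "(\<Sum>m\<in>S. \<Sum>n\<in>S. X n m) = (\<Sum>m\<in>S. \<Sum>n\<in>S. X m n)"
    by (rule sum.swap)
  ultimately have "2 * minor2 (fun_pow a S (Suc p)) i j k l = (\<Sum>m\<in>S. \<Sum>n\<in>S. X m n + X n m)"
    by (simp only: sum.distrib mult_2)
  also have "\<dots> = (\<Sum>m\<in>S. \<Sum>n\<in>S. minor2 P i j m n * minor2 a m n k l)"
    by (intro sum.cong refl) (simp add: X_def algebra_simps)
  finally show ?thesis by (simp only: P_def)
qed

definition minors_sign_symmetric :: "('a \<Rightarrow> 'a \<Rightarrow> real) \<Rightarrow> 'a set \<Rightarrow> bool" where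
  "minors_sign_symmetric a S \<longleftrightarrow>
    (\<exists>s. (\<forall>i\<in>S. \<forall>j\<in>S. s i j * s i j = 1) \<and>
      (\<forall>i\<in>S. \<forall>j\<in>S. \<forall>k\<in>S. \<forall>l\<in>S. 0 \<le> s i j * s k l * minor2 a i j k l))"

lemma minors_sign_symmetricI:
  assumes "\<And>i j. i \<in> S \<Longrightarrow> j \<in> S \<Longrightarrow> s i j * s i j = 1"
    and "\<And>i j k l. i \<in> S \<Longrightarrow> j \<in> S \<Longrightarrow> k \<in> S \<Longrightarrow> l \<in> S \<Longrightarrow> 0 \<le> s i j * s k l * minor2 a i j k l"
  shows "minors_sign_symmetric a S"
  unfolding minors_sign_symmetric_def using assms by (intro exI[of _ s] conjI ballI)

lemma minors_sign_symmetric_subset: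
  assumes "minors_sign_symmetric a S" "T \<subseteq> S"
  shows "minors_sign_symmetric a T"
proof -
  obtain s where s: "\<forall>i\<in>S. \<forall>j\<in>S. s i j * s i j = 1"
    and a: "\<forall>i\<in>S. \<forall>j\<in>S. \<forall>k\<in>S. \<forall>l\<in>S. 0 \<le> s i j * s k l * minor2 a i j k l"
    using assms(1) unfolding minors_sign_symmetric_def by blast
  note s = s[rule_format] and a = a[rule_format]
  show ?thesis
    by (rule minors_sign_symmetricI[where s = s]; rule s a) (use assms(2) in auto)
qed

text \<open>The second compound of a power is the power of the second compound, and a sign condition
  with fixed signs survives products because the inner signs occur squared.\<close>

lemma minors_sign_symmetric_fun_pow:
  assumes "finite S" "minors_sign_symmetric a S" "p > 0"
  shows "minors_sign_symmetric (fun_pow a S p) S"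
proof -
  obtain s where s: "\<forall>i\<in>S. \<forall>j\<in>S. s i j * s i j = 1"
    and a: "\<forall>i\<in>S. \<forall>j\<in>S. \<forall>k\<in>S. \<forall>l\<in>S. 0 \<le> s i j * s k l * minor2 a i j k l"
    using assms(2) unfolding minors_sign_symmetric_def by blast
  note s = s[rule_format] and a = a[rule_format]
  have "0 \<le> s i j * s k l * minor2 (fun_pow a S p) i j k l"
    if "i \<in> S" "j \<in> S" "k \<in> S" "l \<in> S" for i j k l
    \<comment> \<open>The induction starts at exponent 1: for the identity matrix the fixed signs
      would have to satisfy \<open>s j i = - s i j\<close> for distinct \<open>i\<close>,
      \<open>j\<close>.\<close>
    using assms(3) that
  proof (induction p arbitrary: k l rule: nat_induct_non_zero)
    case 1
    have "fun_pow a S (Suc 0) x y = a x y" if "x \<in> S" for x y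
      using that assms(1) by (simp add: if_distrib[of "\<lambda>x. x * _"] cong: if_cong)
    with 1 show ?case
      using a[OF 1] by (simp only: One_nat_def)
  next
    case (Suc p)
    let ?P = "fun_pow a S p"
    have "2 * (s i j * s k l * minor2 (fun_pow a S (Suc p)) i j k l) =
      s i j * s k l * (\<Sum>m\<in>S. \<Sum>n\<in>S. minor2 ?P i j m n * minor2 a m n k l)"
      unfolding minor2_fun_pow_Suc [symmetric] by (rule mult.left_commute)
    \<comment> \<open>Inserting \<open>s m n * s m n = 1\<close> distributes the signs over the two
      minors.\<close>
    also have "\<dots> = (\<Sum>m\<in>S. \<Sum>n\<in>S. (s i j * s m n * minor2 ?P i j m n) * (s m n * s k l * minor2 a m n k l))"
      unfolding sum_distrib_left
    proof (intro sum.cong refl)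
      fix m n assume "m \<in> S" "n \<in> S"
      then have "s i j * s k l * (minor2 ?P i j m n * minor2 a m n k l) =
          s i j * s k l * (minor2 ?P i j m n * minor2 a m n k l) * (s m n * s m n)"
        by (simp add: s)
      then show "s i j * s k l * (minor2 ?P i j m n * minor2 a m n k l) =
          (s i j * s m n * minor2 ?P i j m n) * (s m n * s k l * minor2 a m n k l)"
        by (simp only: mult_ac)
    qed
    also have "\<dots> \<ge> 0"
      by (rule sum_nonneg, rule sum_nonneg, rule mult_nonneg_nonneg[OF Suc.IH a]) (use Suc.prems in auto)
    finally show ?case
      by linarith
  qed
  then show ?thesis
    by (intro minors_sign_symmetricI[where s = s] s)
qed

text \<open>In the principal minor on \<open>i\<close>, \<open>k\<close> of the p-th power the sign
  is a square, so the minor is nonnegative. With zero diagonal it is minus the product of the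
  entries at \<open>(i, k)\<close> and \<open>(k, i)\<close>, which therefore vanishes; these
  products sum to the diagonal entry of the power \<open>2 * p\<close>.\<close>

lemma fun_pow_double_diag_eq_0:
  fixes a :: "'a \<Rightarrow> 'a \<Rightarrow> real"
  assumes S: "finite S" and a: "\<And>i j. i \<in> S \<Longrightarrow> j \<in> S \<Longrightarrow> 0 \<le> a i j"
    and minors: "minors_sign_symmetric a S" and p: "p > 0"
    and diag: "\<And>i. i \<in> S \<Longrightarrow> fun_pow a S p i i = 0" and i: "i \<in> S"
  shows "fun_pow a S (2 * p) i i = 0"
proof -
  obtain s where s: "\<forall>i\<in>S. \<forall>j\<in>S. s i j * s i j = 1"
    and m: "\<forall>i\<in>S. \<forall>j\<in>S. \<forall>k\<in>S. \<forall>l\<in>S. 0 \<le> s i j * s k l * minor2 (fun_pow a S p) i j k l"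
    using minors_sign_symmetric_fun_pow[OF S minors p] unfolding minors_sign_symmetric_def by blast
  note s = s[rule_format] and m = m[rule_format]
  have "fun_pow a S p i k * fun_pow a S p k i = 0" if k: "k \<in> S" for k
  proof (rule antisym)
    show "fun_pow a S p i k * fun_pow a S p k i \<le> 0"
      using m[OF i k i k] diag[OF i] by (simp add: s[OF i k])
    show "0 \<le> fun_pow a S p i k * fun_pow a S p k i"
      by (intro mult_nonneg_nonneg fun_pow_nonneg a i k)
  qed
  then show ?thesis
    by (simp add: mult_2 fun_pow_add[OF S i])
qed

section \<open>Peripheral spectrum of irreducible nonnegative matrices\<close>

text \<open>With \<open>s\<close> the sum, the deficits
  \<open>cmod (f j) * cmod s - Re (f j * cnj s)\<close> are nonnegative and add up to 0, so each is
  0 and every term points in the direction of \<open>s\<close>.\<close>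

lemma norm_sum_eq_imp_aligned:
  fixes f :: "'a \<Rightarrow> complex"
  assumes S: "finite S" and eq: "cmod (sum f S) = (\<Sum>j\<in>S. cmod (f j))" and j: "j \<in> S"
  shows "f j * cmod (sum f S) = cmod (f j) * sum f S"
proof (cases "sum f S = 0")
  case True
  with eq S j have "f j = 0"
    by (simp add: sum_nonneg_eq_0_iff)
  with True show ?thesis by simp
next
  case False
  define s where "s = sum f S"
  have "(\<Sum>j\<in>S. Re (f j * cnj s)) = (cmod s)\<^sup>2"
    by (simp only: Re_sum [symmetric] sum_distrib_right [symmetric] s_def [symmetric] complex_norm_square [symmetric] Re_complex_of_real)
  moreover have "(\<Sum>j\<in>S. cmod (f j) * cmod s) = (cmod s)\<^sup>2"
    by (simp only: sum_distrib_right [symmetric] eq [symmetric] s_def [symmetric] power2_eq_square)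
  ultimately have "(\<Sum>j\<in>S. cmod (f j) * cmod s - Re (f j * cnj s)) = 0"
    by (simp add: sum_subtractf)
  moreover have "0 \<le> cmod (f j) * cmod s - Re (f j * cnj s)" for j
    using complex_Re_le_cmod[of "f j * cnj s"] by (simp add: norm_mult)
  ultimately have "Re (f j * cnj s) = cmod (f j) * cmod s"
    using S j by (subst (asm) sum_nonneg_eq_0_iff) auto
  then have "Re (f j * cnj s) = cmod (f j * cnj s)"
    by (simp add: norm_mult)
  then have "Im (f j * cnj s) = 0"
    using cmod_power2[of "f j * cnj s"] by simp
  with \<open>Re (f j * cnj s) = cmod (f j * cnj s)\<close> have "f j * cnj s = cmod (f j * cnj s)"
    by (intro complex_eqI) simp_all
  then have "f j * (cnj s * s) = cmod (f j) * cmod s * s"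
    by (simp add: norm_mult mult.assoc [symmetric])
  also have "cnj s * s = cmod s * cmod s"
    by (metis complex_norm_square mult.commute power2_eq_square of_real_mult)
  finally have "cmod s * (f j * cmod s) = cmod s * (cmod (f j) * s)"
    by (simp only: mult_ac of_real_mult)
  with False show ?thesis by (simp add: s_def)
qed

text \<open>Multiplication by an element \<open>z\<close> permutes \<open>G\<close>; comparing the
  products of all elements gives \<open>z ^ card G = 1\<close>, and there are only
  \<open>card G\<close> such roots.\<close>

lemma finite_multiplicative_eq_roots_of_unity:
  fixes G :: "complex set"
  assumes G: "finite G" "G \<noteq> {}" "0 \<notin> G" and mult: "\<And>x y. x \<in> G \<Longrightarrow> y \<in> G \<Longrightarrow> x * y \<in> G"
  shows "G = {z. z ^ card G = 1}"
proof (rule card_subset_eq)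
  have "card G > 0"
    using G by (simp add: card_gt_0_iff)
  then show "finite {z::complex. z ^ card G = 1}" "card G = card {z::complex. z ^ card G = 1}"
    by (auto simp: card_roots_unity_eq intro: finite_roots_unity)
  show "G \<subseteq> {z. z ^ card G = 1}"
  proof safe
    fix z assume z: "z \<in> G"
    have inj: "inj_on ((*) z) G"
      using z G(3) by (auto intro!: inj_onI)
    then have "(*) z ` G = G"
      using z G(1) mult by (intro endo_inj_surj) auto
    then have "\<Prod>G = (\<Prod>y\<in>G. z * y)"
      using prod.reindex[OF inj, of "\<lambda>y. y"] by simp
    also have "\<dots> = z ^ card G * \<Prod>G"
      by (simp add: prod.distrib)
    finally show "z ^ card G = 1"
      using G by (simp add: prod_zero_iff)
  qed
qed

lemma count_image_mset_inj:
  "inj f \<Longrightarrow> count (image_mset f M) (f x) = count M x"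
  by (induction M) (auto dest: injD)

text \<open>Peripheral terms are constantly 1 and the others tend to 0. The exponents are odd
  multiples of \<open>h\<close> so that, for even \<open>h\<close>, their halves are odd multiples
  of \<open>h / 2\<close>.\<close>

lemma sum_powers_tendsto_peripheral:
  fixes M :: "complex multiset"
  assumes "\<And>z. z \<in># M \<Longrightarrow> cmod z \<le> 1" "\<And>z. z \<in># M \<Longrightarrow> cmod z = 1 \<Longrightarrow> z ^ h = 1" and h: "h > 0"
  shows "(\<lambda>q. \<Sum>z\<in>#M. z ^ (h * (2 * q + 1))) \<longlonglongrightarrow> of_nat (size {#z \<in># M. cmod z = 1#})"
  using assms(1,2)
proof (induction M)
  case (add x M)
  have "(\<lambda>q. x ^ (h * (2 * q + 1))) \<longlonglongrightarrow> (if cmod x = 1 then 1 else 0)"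
  proof (cases "cmod x = 1")
    case True
    then show ?thesis
      using add.prems(2)[of x] by (simp only: power_mult) simp
  next
    case False
    with add.prems(1)[of x] have "cmod x < 1" by simp
    then have "(\<lambda>n. x ^ n) \<longlonglongrightarrow> 0"
      by (rule LIMSEQ_power_zero)
    moreover have "strict_mono (\<lambda>q. h * (2 * q + 1))"
      using h by (auto intro!: strict_monoI)
    ultimately show ?thesis
      using False LIMSEQ_subseq_LIMSEQ[of "\<lambda>n. x ^ n"] by (fastforce simp: o_def)
  qed
  from tendsto_add[OF this add.IH] add.prems show ?case
    by auto
qed simp

section \<open>Subinvariant vectors and rotational symmetry of the spectrum\<close>

text \<open>Irreducibility is strong connectivity stated by cuts: no nonempty proper index set is
  closed under nonzero entries. The spectral radius is only bounded by 1, since diagonal blocks of a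
  reducible matrix may have a smaller one.\<close>

locale irreducible_nonneg =
  fixes a :: "'a \<Rightarrow> 'a \<Rightarrow> real" and xs :: "'a list"
  assumes distinct: "distinct xs"
    and nonneg: "i \<in> set xs \<Longrightarrow> j \<in> set xs \<Longrightarrow> 0 \<le> a i j"
    and irreducible: "T \<subseteq> set xs \<Longrightarrow> T \<noteq> {} \<Longrightarrow> T \<noteq> set xs \<Longrightarrow> \<exists>i\<in>T. \<exists>j\<in>set xs - T. a i j \<noteq> 0"
    and spec_le_1: "z \<in># fun_spec (\<lambda>i j. complex_of_real (a i j)) xs \<Longrightarrow> cmod z \<le> 1"
begin

abbreviation "S \<equiv> set xs"
abbreviation "ac \<equiv> \<lambda>i j. complex_of_real (a i j)"
abbreviation "spec \<equiv> fun_spec ac xs"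

definition act :: "('a \<Rightarrow> real) \<Rightarrow> 'a \<Rightarrow> real" where
  "act w i = (\<Sum>j\<in>S. a i j * w j)"

lemma act_nonneg: "(\<And>j. j \<in> S \<Longrightarrow> 0 \<le> w j) \<Longrightarrow> i \<in> S \<Longrightarrow> 0 \<le> act w i"
  unfolding act_def by (intro sum_nonneg mult_nonneg_nonneg nonneg)

lemma act_add: "act (\<lambda>i. v i + w i) i = act v i + act w i"
  by (simp add: act_def algebra_simps sum.distrib)

lemma act_pos:
  assumes "\<And>j. j \<in> S \<Longrightarrow> 0 \<le> w j" "i \<in> S" "j \<in> S" "a i j \<noteq> 0" "w j > 0"
  shows "act w i > 0"
proof -
  have "0 < a i j * w j"
    using assms nonneg[of i j] by simp
  also have "\<dots> \<le> act w i"
    unfolding act_def using assms nonneg by (intro member_le_sum) auto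
  finally show ?thesis .
qed

definition supervector :: "('a \<Rightarrow> real) \<Rightarrow> bool" where
  "supervector w \<longleftrightarrow> (\<forall>i\<in>S. 0 \<le> w i \<and> w i \<le> act w i)"

definition strict :: "('a \<Rightarrow> real) \<Rightarrow> 'a set" where
  "strict w = {i \<in> S. w i < act w i}"

text \<open>Passing from \<open>w\<close> to \<open>w + a w\<close> replaces the excess \<open>y = a w - w\<close> by \<open>y + a y\<close>,
  whose support is strictly larger by irreducibility.\<close>

lemma strict_supervector_enlarge:
  assumes w: "supervector w" and ne: "strict w \<noteq> {}" "strict w \<noteq> S"
  obtains v where "supervector v" "card (strict w) < card (strict v)"
proof -
  let ?y = "\<lambda>i. act w i - w i"
  define v where "v i = w i + act w i" for i
  have y: "0 \<le> ?y j" if "j \<in> S" for j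
    using w that by (auto simp: supervector_def)
  have v_diff: "act v i - v i = ?y i + act ?y i" for i
    by (simp add: v_def[abs_def] act_add) (simp add: act_def algebra_simps sum_subtractf)
  have yy: "0 \<le> act ?y i" if "i \<in> S" for i
    using act_nonneg[of ?y] y that by blast
  have "supervector v"
    unfolding supervector_def
  proof (intro ballI conjI)
    fix i assume i: "i \<in> S"
    show "0 \<le> v i"
      unfolding v_def using w i by (auto simp: supervector_def)
    show "v i \<le> act v i"
      using v_diff[of i] y[OF i] yy[OF i] by simp
  qed
  moreover have "strict w \<subseteq> strict v"
  proof
    fix i assume "i \<in> strict w"
    then show "i \<in> strict v"
      using v_diff[of i] yy[of i] by (simp add: strict_def)
  qed
  moreover obtain i j where ij: "i \<in> S - strict w" "j \<in> strict w" "a i j \<noteq> 0"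
    using irreducible[of "S - strict w"] ne by (auto simp: strict_def)
  then have "act ?y i > 0"
    using y by (intro act_pos[of ?y i j]) (auto simp: strict_def)
  then have "i \<in> strict v"
    using v_diff[of i] y[of i] ij by (simp add: strict_def)
  ultimately have "supervector v" "strict w \<subset> strict v"
    using ij by blast+
  moreover have "finite (strict v)"
    by (simp add: strict_def)
  ultimately show thesis
    using that psubset_card_mono by blast
qed

text \<open>Otherwise the smallest ratio \<open>r\<close> of \<open>act w i\<close> to
  \<open>w i\<close> would exceed 1 and satisfy \<open>r * w i \<le> act w i\<close> throughout,
  against the spectral bound.\<close>

lemma not_strict_everywhere:
  assumes w: "supervector w" and ne: "S \<noteq> {}"
  shows "strict w \<noteq> S"
proof
  assume "strict w = S"
  then have lt: "w i < act w i" if "i \<in> S" for i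
    using that by (auto simp: strict_def)
  have "\<exists>i\<in>S. w i > 0"
  proof (rule ccontr)
    assume "\<not> (\<exists>i\<in>S. w i > 0)"
    then have w0: "w i = 0" if "i \<in> S" for i
      using w that by (force simp: supervector_def)
    then have "act w i = 0" for i
      by (simp add: act_def)
    with lt w0 ne show False by fastforce
  qed
  then obtain i where i: "i \<in> S" "w i > 0" by blast
  \<comment> \<open>Only positive entries of \<open>w\<close> enter the minimum, as a quotient by 0
    would be 0; at zero entries the estimate by \<open>r\<close> is mere nonnegativity of
    \<open>act w\<close>.\<close>
  let ?R = "(\<lambda>i. act w i / w i) ` {i \<in> S. w i > 0}"
  have fin: "finite ?R" and R: "?R \<noteq> {}"
    using i by auto
  define r where "r = Min ?R"
  have "r \<in> ?R"
    unfolding r_def using fin R by (rule Min_in)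
  then have r: "r > 1"
    using lt by (auto simp: field_simps)
  have "r * w j \<le> act w j" if "j \<in> S" for j
  proof (cases "w j > 0")
    case True
    then have "r \<le> act w j / w j"
      unfolding r_def using that by (intro Min_le fin) auto
    with True show ?thesis by (simp add: field_simps)
  next
    case False
    with w that have "w j = 0" by (force simp: supervector_def)
    moreover have "0 \<le> act w j"
      using w that by (intro act_nonneg) (auto simp: supervector_def)
    ultimately show ?thesis by simp
  qed
  then have "r \<le> 1"
    unfolding act_def
    using w i r by (intro supervector_ratio_le_1[OF distinct nonneg spec_le_1, where r = r and w = w and i = i])
      (auto simp: supervector_def)
  with r show False by simp
qed

text \<open>Otherwise some supervector has a nonempty strict set. One whose strict set is largest is
  not strict everywhere, so it could still be enlarged.\<close>

lemma supervector_eigenvector: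
  assumes "supervector w" "i \<in> S"
  shows "act w i = w i"
proof (rule ccontr)
  assume "act w i \<noteq> w i"
  with assms have "strict w \<noteq> {}"
    by (force simp: strict_def supervector_def)
  let ?P = "\<lambda>v. supervector v \<and> strict v \<noteq> {}"
  have "\<exists>v. ?P v \<and> (\<forall>u. ?P u \<longrightarrow> card (strict u) \<le> card (strict v))"
  proof (rule ex_has_greatest_nat)
    show "?P w" using assms \<open>strict w \<noteq> {}\<close> by simp
    show "\<forall>v. ?P v \<longrightarrow> card (strict v) < Suc (card S)"
      by (auto simp: strict_def less_Suc_eq_le intro: card_mono)
  qed
  then obtain v where v: "?P v" and max: "\<And>u. ?P u \<Longrightarrow> card (strict u) \<le> card (strict v)"
    by blast
  have "strict v \<noteq> S"
    using v assms by (intro not_strict_everywhere) auto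
  then obtain u where u: "supervector u" "card (strict v) < card (strict u)"
    using strict_supervector_enlarge v by metis
  with max[of u] show False by fastforce
qed

text \<open>Irreducibility would link a zero of \<open>w\<close> to a nonzero entry and make
  \<open>act w\<close> positive where \<open>w\<close> vanishes, although \<open>w\<close> is a
  fixed vector.\<close>

lemma supervector_pos:
  assumes w: "supervector w" and ne: "\<exists>i\<in>S. w i \<noteq> 0" and i: "i \<in> S"
  shows "w i > 0"
proof (rule ccontr)
  assume "\<not> w i > 0"
  with w i have "w i = 0" by (force simp: supervector_def)
  with i ne obtain k j where kj: "k \<in> {k \<in> S. w k = 0}" "j \<in> S - {k \<in> S. w k = 0}" "a k j \<noteq> 0"
    using irreducible[of "{k \<in> S. w k = 0}"] by blast
  then have "act w k > 0"
    using w by (intro act_pos[of w k j]) (auto simp: supervector_def less_le)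
  with supervector_eigenvector[OF w, of k] kj show False by simp
qed

text \<open>Wielandt's argument: the moduli of an eigenvector \<open>z\<close> for \<open>l\<close>
  form a supervector, hence a positive fixed vector. So equality holds in the triangle inequality of
  each row, which aligns the phases \<open>sgn (z i)\<close>; these serve as
  \<open>\<phi>\<close>.\<close>

lemma peripheral_phase:
  assumes l: "l \<in># spec" "cmod l = 1"
  obtains \<phi> where "\<And>i. i \<in> S \<Longrightarrow> \<phi> i \<noteq> 0"
    and "\<And>i j. i \<in> S \<Longrightarrow> j \<in> S \<Longrightarrow> ac i j * \<phi> j = \<phi> i * (l * ac i j)"
proof -
  obtain z where z: "\<exists>i\<in>S. z i \<noteq> 0" "\<And>i. i \<in> S \<Longrightarrow> (\<Sum>j\<in>S. ac i j * z j) = l * z i"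
    using l by (auto simp: in_fun_spec_iff eigenvalue_fun_mat_iff[OF distinct])
  define w where "w i = cmod (z i)" for i
  have abs_sum: "(\<Sum>j\<in>S. cmod (ac i j * z j)) = act w i" if "i \<in> S" for i
    unfolding act_def w_def using nonneg that by (intro sum.cong) (auto simp: norm_mult)
  have w: "supervector w"
    unfolding supervector_def
  proof (intro ballI conjI)
    fix i assume i: "i \<in> S"
    show "w i \<le> act w i"
      using abs_sum[OF i] norm_sum[of "\<lambda>j. ac i j * z j" S] z(2)[OF i] l(2)
      by (simp add: w_def norm_mult)
  qed (simp add: w_def)
  have z_nz: "z i \<noteq> 0" if "i \<in> S" for i
    using supervector_pos[OF w _ that] z(1) by (auto simp: w_def)
  show thesis
  proof (rule that)
    fix i assume i: "i \<in> S"
    then show "sgn (z i) \<noteq> 0"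
      using z_nz by (simp add: sgn_zero_iff)
    fix j assume j: "j \<in> S"
    have "cmod (\<Sum>j\<in>S. ac i j * z j) = (\<Sum>j\<in>S. cmod (ac i j * z j))"
      using supervector_eigenvector[OF w i] abs_sum[OF i] z(2)[OF i] l(2)
      by (simp add: w_def norm_mult)
    from norm_sum_eq_imp_aligned[OF finite_set this j]
    have "ac i j * z j * cmod (z i) = a i j * cmod (z j) * (l * z i)"
      using z(2)[OF i] l(2) nonneg[OF i j] by (simp add: norm_mult)
    then show "ac i j * sgn (z j) = sgn (z i) * (l * ac i j)"
      using z_nz[OF i] z_nz[OF j] by (simp add: sgn_div_norm scaleR_conv_of_real field_simps)
  qed
qed

text \<open>The phases give a diagonal similarity between \<open>a\<close> and its multiple by
  \<open>l\<close>.\<close>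

lemma spec_rotate:
  assumes l: "l \<in># spec" "cmod l = 1"
  shows "spec = image_mset ((*) l) spec"
proof -
  obtain \<phi> where \<phi>: "\<And>i. i \<in> S \<Longrightarrow> \<phi> i \<noteq> 0"
    "\<And>i j. i \<in> S \<Longrightarrow> j \<in> S \<Longrightarrow> ac i j * \<phi> j = \<phi> i * (l * ac i j)"
    using peripheral_phase[OF l] by blast
  have "spec = fun_spec (\<lambda>i j. l * ac i j) xs"
    using \<phi> by (intro fun_spec_eqI[where d = \<phi>] distinct refl)
  then show ?thesis
    by (simp only: fun_spec_smult)
qed

text \<open>The phase similarity multiplies the p-th power by \<open>l ^ p\<close>; on the diagonal
  the phases cancel, leaving an entry equal to \<open>l ^ p\<close> times itself.\<close>

lemma fun_pow_diag_rotate: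
  assumes l: "l \<in># spec" "cmod l = 1" and p: "l ^ p \<noteq> 1" and i: "i \<in> S"
  shows "fun_pow a S p i i = 0"
proof -
  obtain \<phi> where \<phi>: "\<And>i. i \<in> S \<Longrightarrow> \<phi> i \<noteq> 0"
    "\<And>i j. i \<in> S \<Longrightarrow> j \<in> S \<Longrightarrow> ac i j * \<phi> j = \<phi> i * (l * ac i j)"
    using peripheral_phase[OF l] by blast
  have "fun_pow ac S p i j * \<phi> j = \<phi> i * (l ^ p * fun_pow ac S p i j)" if "j \<in> S" for j
    using that
  proof (induction p arbitrary: j)
    case (Suc p)
    have "fun_pow ac S (Suc p) i j * \<phi> j = (\<Sum>k\<in>S. fun_pow ac S p i k * (ac k j * \<phi> j))"
      by (simp add: sum_distrib_right mult.assoc)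
    also have "\<dots> = (\<Sum>k\<in>S. (fun_pow ac S p i k * \<phi> k) * (l * ac k j))"
      using Suc.prems by (intro sum.cong refl) (simp only: \<phi>(2) mult.assoc)
    also have "\<dots> = (\<Sum>k\<in>S. \<phi> i * (l ^ p * fun_pow ac S p i k) * (l * ac k j))"
      using Suc.IH by (intro sum.cong refl) simp
    also have "\<dots> = \<phi> i * (l ^ Suc p * fun_pow ac S (Suc p) i j)"
      by (simp add: sum_distrib_left mult_ac)
    finally show ?case .
  qed simp
  from this[OF i] have "fun_pow ac S p i i = l ^ p * fun_pow ac S p i i"
    using \<phi>(1)[OF i] by simp
  with p have "fun_pow ac S p i i = 0"
    by (metis mult_cancel_right1)
  then show ?thesis
    by (simp add: fun_pow_of_real)
qed

text \<open>Rotations by peripheral eigenvalues preserve multiplicities, so these eigenvalues form a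
  group of roots of unity with a common multiplicity; the minor condition excludes even
  order.\<close>

lemma peripheral_spec:
  assumes minors: "minors_sign_symmetric a S"
  obtains m h where "odd h" "{#z \<in># spec. cmod z = 1#} = repeat_mset m (mset_set {z. z ^ h = 1})"
proof (cases "\<exists>l. l \<in># spec \<and> cmod l = 1")
  case False
  then have "{#z \<in># spec. cmod z = 1#} = {#}"
    by auto
  \<comment> \<open>The empty multiset is encoded by \<open>h = 1\<close> and
    \<open>m = 0\<close>.\<close>
  then show thesis
    using that[of 1 0] by simp
next
  case True
  define G where "G = {z. z \<in># spec \<and> cmod z = 1}"
  define h where "h = card G"
  have fin: "finite G"
    by (rule finite_subset[of _ "set_mset spec"]) (auto simp: G_def)
  have count_rotate: "count spec (l * z) = count spec z" if "l \<in> G" for l z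
  proof -
    have "count spec (l * z) = count (image_mset ((*) l) spec) (l * z)"
      using spec_rotate[of l] that by (simp add: G_def)
    also have "\<dots> = count spec z"
      using that by (intro count_image_mset_inj injI) (auto simp: G_def)
    finally show ?thesis .
  qed
  have "l * z \<in> G" if "l \<in> G" "z \<in> G" for l z
    using count_rotate[of l z] that by (auto simp: G_def norm_mult simp flip: count_greater_zero_iff)
  then have G: "G = {z. z ^ h = 1}"
    unfolding h_def using fin True by (intro finite_multiplicative_eq_roots_of_unity) (auto simp: G_def)
  have h: "h > 0"
    unfolding h_def using fin True by (auto simp: card_gt_0_iff G_def)
  \<comment> \<open>Rotation by \<open>z\<close> takes 1 to \<open>z\<close>, so all elements of
    \<open>G\<close> share the multiplicity of 1.\<close>
  have periph: "{#z \<in># spec. cmod z = 1#} = repeat_mset (count spec 1) (mset_set G)"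
  proof (rule multiset_eqI)
    fix z
    show "count {#z \<in># spec. cmod z = 1#} z = count (repeat_mset (count spec 1) (mset_set G)) z"
    proof (cases "z \<in> G")
      case True
      with count_rotate[of z 1] fin show ?thesis by (simp add: G_def)
    next
      case False
      with fin show ?thesis by (auto simp: G_def not_in_iff)
    qed
  qed
  have "odd h"
  proof
    assume "even h"
    then obtain g where g: "h = 2 * g" by blast
    \<comment> \<open>Powers of \<open>a\<close> whose exponent is an odd multiple of \<open>h / 2\<close> have zero diagonal, which by the
      minor condition forces zero trace of \<open>a\<close> to every odd multiple of \<open>h\<close>; but these traces
      tend to the number of peripheral eigenvalues.\<close>
    define l where "l = cis (pi / real g)"
    have "l ^ g = - 1"
      using g h by (simp add: l_def DeMoivre)
    then have l: "l \<in> G" "l ^ (g * (2 * q + 1)) \<noteq> 1" for q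
      by (simp_all add: G g power_mult mult.commute[of 2 g] power_add del: mult_Suc_right)
    have zero: "(\<Sum>z\<in>#spec. z ^ (h * (2 * q + 1))) = 0" for q
    proof -
      let ?p = "g * (2 * q + 1)"
      have "fun_pow a S (2 * ?p) i i = 0" if "i \<in> S" for i
        by (rule fun_pow_double_diag_eq_0[OF finite_set nonneg minors])
          (use l g h that fun_pow_diag_rotate[of l ?p] in \<open>auto simp: G_def\<close>)
      then have "(\<Sum>i\<in>S. fun_pow ac S (2 * ?p) i i) = 0"
        by (simp add: fun_pow_of_real)
      then show ?thesis
        using trace_fun_pow[OF distinct, of ac "2 * ?p"] by (simp add: g mult.assoc)
    qed
    have "(\<lambda>q. \<Sum>z\<in>#spec. z ^ (h * (2 * q + 1))) \<longlonglongrightarrow> of_nat (size {#z \<in># spec. cmod z = 1#})"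
      by (rule sum_powers_tendsto_peripheral[OF spec_le_1 _ h]) (use G in \<open>auto simp: G_def\<close>)
    then have "size {#z \<in># spec. cmod z = 1#} = 0"
      unfolding zero by (simp add: LIMSEQ_const_iff)
    with True show False by auto
  qed
  with that periph G show thesis by metis
qed

end

section \<open>Reducible matrices and the second compound\<close>

lemma repeat_mset_sum_list_replicate: "sum_list (replicate m M) = repeat_mset m M"
  by (induction m) auto

text \<open>Induction on the number of indices: a reducible matrix is permuted into block triangular
  form, its spectrum is the sum of the spectra of two diagonal blocks, and both blocks inherit the
  hypotheses.\<close>

lemma peripheral_fun_spec:
  fixes a :: "'a \<Rightarrow> 'a \<Rightarrow> real"
  assumes "distinct xs" "\<And>i j. i \<in> set xs \<Longrightarrow> j \<in> set xs \<Longrightarrow> 0 \<le> a i j"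
    and "\<And>z. z \<in># fun_spec (\<lambda>i j. complex_of_real (a i j)) xs \<Longrightarrow> cmod z \<le> 1"
    and "minors_sign_symmetric a (set xs)"
  shows "\<exists>hs. (\<forall>h\<in>set hs. odd h) \<and>
    {#z \<in># fun_spec (\<lambda>i j. complex_of_real (a i j)) xs. cmod z = 1#} =
    (\<Sum>h\<leftarrow>hs. mset_set {z. z ^ h = 1})"
  using assms
proof (induction "length xs" arbitrary: xs rule: less_induct)
  case less
  let ?a = "\<lambda>i j. complex_of_real (a i j)"
  show ?case
  proof (cases "\<exists>T. T \<subseteq> set xs \<and> T \<noteq> {} \<and> T \<noteq> set xs \<and> (\<forall>i\<in>T. \<forall>j\<in>set xs - T. a i j = 0)")
    case True
    then obtain T where T: "T \<subseteq> set xs" "T \<noteq> {}" "T \<noteq> set xs"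
      and zero: "\<And>i j. i \<in> T \<Longrightarrow> j \<in> set xs - T \<Longrightarrow> a i j = 0"
      by auto
    \<comment> \<open>\<open>T\<close> comes last in \<open>us @ vs\<close>, because the entries
      from \<open>T\<close> to its complement vanish and must form the lower left block.\<close>
    define us where "us = filter (\<lambda>i. i \<notin> T) xs"
    define vs where "vs = filter (\<lambda>i. i \<in> T) xs"
    have sub: "set us \<subseteq> set xs" "set vs \<subseteq> set xs" and dist: "distinct us" "distinct vs"
      using less.prems(1) by (auto simp: us_def vs_def)
    have "fun_spec ?a xs = fun_spec ?a (us @ vs)"
      by (rule fun_spec_eqI[where d = "\<lambda>_. 1"]) (use less.prems(1) in \<open>auto simp: us_def vs_def\<close>)
    then have spec: "fun_spec ?a xs = fun_spec ?a us + fun_spec ?a vs"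
      using zero by (subst (asm) fun_spec_append) (auto simp: us_def vs_def)
    have len: "length us < length xs" "length vs < length xs"
      unfolding us_def vs_def using T by (auto intro: length_filter_less)
    have "\<exists>hs. (\<forall>h\<in>set hs. odd h) \<and> {#z \<in># fun_spec ?a us. cmod z = 1#} = (\<Sum>h\<leftarrow>hs. mset_set {z. z ^ h = 1})"
      using less.prems(3) spec
      by (intro less.hyps len dist minors_sign_symmetric_subset[OF less.prems(4) sub(1)]
          less.prems(2) subsetD[OF sub(1)]) auto
    moreover have "\<exists>hs. (\<forall>h\<in>set hs. odd h) \<and> {#z \<in># fun_spec ?a vs. cmod z = 1#} = (\<Sum>h\<leftarrow>hs. mset_set {z. z ^ h = 1})"
      using less.prems(3) spec
      by (intro less.hyps len dist minors_sign_symmetric_subset[OF less.prems(4) sub(2)]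
          less.prems(2) subsetD[OF sub(2)]) auto
    ultimately obtain hs ks where
      "\<forall>h\<in>set hs. odd h" "{#z \<in># fun_spec ?a us. cmod z = 1#} = (\<Sum>h\<leftarrow>hs. mset_set {z. z ^ h = 1})"
      "\<forall>h\<in>set ks. odd h" "{#z \<in># fun_spec ?a vs. cmod z = 1#} = (\<Sum>h\<leftarrow>ks. mset_set {z. z ^ h = 1})"
      by blast
    then show ?thesis
      by (intro exI[of _ "hs @ ks"]) (auto simp: spec)
  next
    case False
    interpret irreducible_nonneg a xs
      by unfold_locales (use less.prems False in blast)+
    obtain m h where "odd h" "{#z \<in># fun_spec ?a xs. cmod z = 1#} = repeat_mset m (mset_set {z. z ^ h = 1})"
      using peripheral_spec[OF less.prems(4)] .
    then show ?thesis
      by (intro exI[of _ "replicate m h"]) (auto simp: map_replicate repeat_mset_sum_list_replicate)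
  qed
qed

section \<open>From the matrix hypotheses to sign conditions\<close>

text \<open>With sign -1 on \<open>J\<close> and 1 off it, the first condition handles entries
  between \<open>J\<close> and its complement, and the contrapositive of the second makes all other
  entries nonnegative.\<close>

lemma J_sign_symmetricE:
  assumes "J_sign_symmetric M"
  obtains s :: "nat \<Rightarrow> real" where "\<And>i. s i * s i = 1"
    and "\<And>i j. i < dim_row M \<Longrightarrow> j < dim_row M \<Longrightarrow> 0 \<le> s i * s j * M $$ (i, j)"
proof -
  obtain J where J: "\<forall>i<dim_row M. \<forall>j<dim_row M.
      ((i \<in> J) \<noteq> (j \<in> J) \<longrightarrow> M $$ (i, j) \<le> 0) \<and> (M $$ (i, j) < 0 \<longrightarrow> (i \<in> J) \<noteq> (j \<in> J))"
    using assms unfolding J_sign_symmetric_def by blast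
  define s where "s i = (if i \<in> J then - 1 else 1 :: real)" for i
  have "0 \<le> s i * s j * M $$ (i, j)" if "i < dim_row M" "j < dim_row M" for i j
    using J[rule_format, OF that] by (auto simp: s_def not_less[symmetric])
  moreover have "s i * s i = 1" for i
    by (simp add: s_def)
  ultimately show thesis
    using that by blast
qed

lemma pick_doubleton:
  assumes "i < j"
  shows "pick {i, j} 0 = i" "pick {i, j} (Suc 0) = j"
proof -
  show i: "pick {i, j} 0 = i"
    unfolding pick.simps by (rule Least_equality) (use assms in auto)
  show "pick {i, j} (Suc 0) = j"
    unfolding pick.simps(2) i by (rule Least_equality) (use assms in auto)
qed

lemma det_2:
  fixes A :: "'a :: comm_ring_1 mat"
  assumes A: "A \<in> carrier_mat 2 2"
  shows "det A = A $$ (0, 0) * A $$ (1, 1) - A $$ (0, 1) * A $$ (1, 0)"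
proof -
  have del: "mat_delete A 0 j \<in> carrier_mat 1 1" for j
    using mat_delete_carrier[OF A] by simp
  have "det A = (\<Sum>j<2. A $$ (0, j) * cofactor A 0 j)"
    by (rule laplace_expansion_row[OF A]) simp
  also have "{..<2::nat} = {0, 1}"
    by auto
  finally have "det A = A $$ (0, 0) * cofactor A 0 0 + A $$ (0, 1) * cofactor A 0 1"
    by simp
  moreover have "cofactor A 0 0 = A $$ (1, 1)" "cofactor A 0 1 = - A $$ (1, 0)"
    using A unfolding cofactor_def det_single[OF del] by (simp_all add: mat_delete_def)
  ultimately show ?thesis
    by simp
qed

lemma det_submatrix_doubleton:
  fixes A :: "'a :: comm_ring_1 mat"
  assumes A: "A \<in> carrier_mat n n" and ij: "i < j" "j < n" and kl: "k < l" "l < n"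
  shows "det (submatrix A {i, j} {k, l}) = minor2 (\<lambda>i j. A $$ (i, j)) i j k l"
proof -
  have "{x. x < n \<and> x \<in> {i, j}} = {i, j}" "{x. x < n \<and> x \<in> {k, l}} = {k, l}"
    using ij kl by auto
  then have card: "card {x. x < dim_row A \<and> x \<in> {i, j}} = 2" "card {x. x < dim_col A \<and> x \<in> {k, l}} = 2"
    using A ij kl by (simp_all only: carrier_matD) auto
  then have "submatrix A {i, j} {k, l} \<in> carrier_mat 2 2"
    by (intro carrier_matI) (simp_all only: dim_submatrix)
  moreover have "submatrix A {i, j} {k, l} $$ (p, q) = A $$ (pick {i, j} p, pick {k, l} q)"
    if "p < 2" "q < 2" for p q
    by (rule submatrix_index) (simp_all only: card that)
  ultimately show ?thesis
    using pick_doubleton[OF ij(1)] pick_doubleton[OF kl(1)] by (simp add: det_2 del: pick.simps)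
qed

lemma minors_sign_symmetric_second_compound:
  assumes A: "A \<in> carrier_mat n n" and J: "J_sign_symmetric (second_compound A)"
  shows "minors_sign_symmetric (\<lambda>i j. A $$ (i, j)) {..<n}"
proof -
  let ?m = "minor2 (\<lambda>i j. A $$ (i, j))"
  obtain s :: "nat \<Rightarrow> real" where s: "\<And>r. s r * s r = 1"
    and pos: "\<And>r c. r < n choose 2 \<Longrightarrow> c < n choose 2 \<Longrightarrow> 0 \<le> s r * s c * second_compound A $$ (r, c)"
    using J_sign_symmetricE[OF J] A by (auto simp: second_compound_def)
  have "\<exists>r<n choose 2. lex_pairs n ! r = (i, j)" if "i < j" "j < n" for i j
    using that set_lex_pairs[of n] by (auto simp: set_eq_iff in_set_conv_nth length_lex_pairs)
  then obtain r where r: "\<And>i j. i < j \<Longrightarrow> j < n \<Longrightarrow> r i j < n choose 2 \<and> lex_pairs n ! r i j = (i, j)"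
    by metis
  \<comment> \<open>Minors change sign when rows or columns are swapped, so the signs extend antisymmetrically.\<close>
  define t where "t i j = (if i < j then s (r i j) else - s (r j i))" for i j
  have ordered: "0 \<le> t i j * t k l * ?m i j k l" if "i < j" "j < n" "k < l" "l < n" for i j k l
    using pos[of "r i j" "r k l"] r[OF that(1,2)] r[OF that(3,4)] A that
    by (simp add: t_def second_compound_def det_submatrix_doubleton[OF A])
  have swap: "t i j * t k l * ?m i j k l = t j i * t k l * ?m j i k l"
      "t i j * t k l * ?m i j k l = t i j * t l k * ?m i j l k" if "i \<noteq> j" "k \<noteq> l" for i j k l
    using that by (auto simp: t_def algebra_simps)
  \<comment> \<open>Since \<open>t\<close> and the minors are both antisymmetric, arbitrary row
    pairs and then arbitrary column pairs reduce to ordered ones.\<close>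
  have half: "0 \<le> t i j * t k l * ?m i j k l" if "i \<noteq> j" "i < n" "j < n" "k < l" "l < n" for i j k l
  proof (cases "i < j")
    case True
    then show ?thesis
      using that by (intro ordered)
  next
    case False
    have "k \<noteq> l" "j < i"
      using that False by auto
    show ?thesis
      unfolding swap(1)[OF \<open>i \<noteq> j\<close> \<open>k \<noteq> l\<close>] by (rule ordered) fact+
  qed
  have "0 \<le> t i j * t k l * ?m i j k l" if "i < n" "j < n" "k < n" "l < n" for i j k l
  proof (cases "i = j \<or> k = l")
    case True
    then have "?m i j k l = 0" by auto
    then show ?thesis by (simp only: mult_zero_right order_refl)
  next
    case False
    then have neq: "i \<noteq> j" "k \<noteq> l" by auto
    show ?thesis
    proof (cases "k < l")
      case True
      then show ?thesis
        using neq that by (intro half)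
    next
      case False
      with neq have "l < k" by simp
      show ?thesis
        unfolding swap(2)[OF neq] by (rule half) fact+
    qed
  qed
  moreover have "t i j * t i j = 1" for i j
    by (simp add: t_def s)
  ultimately show ?thesis
    by (intro minors_sign_symmetricI[where s = t]) auto
qed

lemma eigenvalue_mset_eq_fun_spec:
  assumes "A \<in> carrier_mat n n"
  shows "eigenvalue_mset A = fun_spec (\<lambda>i j. complex_of_real (A $$ (i, j))) [0..<n]"
proof -
  have "map_mat complex_of_real A = fun_mat (\<lambda>i j. complex_of_real (A $$ (i, j))) [0..<n] [0..<n]"
    using assms by (auto simp: fun_mat_def)
  then show ?thesis
    by (simp add: eigenvalue_mset_def fun_spec_def)
qed

text \<open>The embedding of the reals into the complex numbers is an injective homomorphism, so it
  preserves orders of roots.\<close>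

lemma order_char_poly_eq_count:
  assumes A: "A \<in> carrier_mat n n"
  shows "order r (char_poly A) = count (eigenvalue_mset A) (complex_of_real r)"
proof -
  interpret map_poly_inj_idom_divide_hom complex_of_real ..
  have "char_poly (map_mat complex_of_real A) = map_poly complex_of_real (char_poly A)"
    by (rule of_real_hom.char_poly_hom[OF A])
  moreover from this have "map_poly complex_of_real (char_poly A) \<noteq> 0"
    using degree_monic_char_poly[of "map_mat complex_of_real A" n] A by auto
  ultimately show ?thesis
    by (simp add: eigenvalue_mset_def order_hom)
qed

lemma in_eigenvalue_mset_iff:
  assumes "A \<in> carrier_mat n n"
  shows "z \<in># eigenvalue_mset A \<longleftrightarrow> z \<in> spectrum (map_mat complex_of_real A)"
  using assms by (simp add: eigenvalue_mset_eq_fun_spec in_fun_spec_iff spectrum_def)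
    (auto simp: fun_mat_def intro!: arg_cong2[where f = eigenvalue])

lemma real_spectral_radius:
  assumes A: "A \<in> carrier_mat n n" and n: "n > 0"
  shows "\<exists>z. z \<in># eigenvalue_mset A \<and> cmod z = real_spectral_radius A"
    and "z \<in># eigenvalue_mset A \<Longrightarrow> cmod z \<le> real_spectral_radius A"
  using spectral_radius_mem_max[of "map_mat complex_of_real A" n] A n
  by (auto simp: in_eigenvalue_mset_iff[OF A] real_spectral_radius_def)

theorem theorem11:
  fixes A :: "real mat" and n :: nat
  assumes "n \<ge> 2"
    and "A \<in> carrier_mat n n"
    and "J_sign_symmetric A"
    and "J_sign_symmetric (second_compound A)"
    and "real_spectral_radius A > 0"
  shows "eigenvalue A (real_spectral_radius A) \<and>
    (let \<rho> = real_spectral_radius A; m = order \<rho> (char_poly A) in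
       m \<ge> 1 \<and>
       (\<exists>k :: nat \<Rightarrow> nat.
          (\<forall>j\<in>{1..m}. k j \<ge> 1 \<and> odd (k j)) \<and>
          peripheral_mset A =
            (\<Sum>j=1..m. mset_set {z. z ^ k j = complex_of_real \<rho> ^ k j})))"
proof -
  note A = assms(2)
  define \<rho> where "\<rho> = real_spectral_radius A"
  have \<rho>: "\<rho> > 0"
    using assms(5) by (simp add: \<rho>_def)
  obtain s :: "nat \<Rightarrow> real" where s: "\<And>i. s i * s i = 1"
    and sA: "\<And>i j. i < n \<Longrightarrow> j < n \<Longrightarrow> 0 \<le> s i * s j * A $$ (i, j)"
    using J_sign_symmetricE[OF assms(3)] A by auto
  \<comment> \<open>Conjugation by the signature \<open>s\<close> makes \<open>A\<close>
    nonnegative, and division by \<open>\<rho>\<close> moves the spectral circle to the unit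
    circle.\<close>
  define b where "b i j = s i * s j * A $$ (i, j) / \<rho>" for i j
  let ?b = "\<lambda>i j. complex_of_real (b i j)"
  have s_nz: "s i \<noteq> 0" for i
    using s[of i] by auto
  have "fun_spec (\<lambda>i j. complex_of_real (A $$ (i, j))) [0..<n] = fun_spec (\<lambda>i j. complex_of_real \<rho> * ?b i j) [0..<n]"
  proof (rule fun_spec_eqI[where d = "\<lambda>i. complex_of_real (s i)"])
    fix i j
    have "A $$ (i, j) * s j = s i * (\<rho> * b i j)"
      using \<rho> s[of i] by (simp add: b_def mult.assoc[symmetric])
    then show "complex_of_real (A $$ (i, j)) * complex_of_real (s j) =
        complex_of_real (s i) * (complex_of_real \<rho> * complex_of_real (b i j))"
      by (simp flip: of_real_mult)
  qed (simp_all add: s_nz)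
  then have spec: "eigenvalue_mset A = image_mset ((*) (complex_of_real \<rho>)) (fun_spec ?b [0..<n])"
    by (simp add: eigenvalue_mset_eq_fun_spec[OF A] fun_spec_smult)
  have le_1: "cmod z \<le> 1" if "z \<in># fun_spec ?b [0..<n]" for z
    using real_spectral_radius(2)[OF A, of "complex_of_real \<rho> * z"] assms(1) that \<rho>
    by (simp add: spec norm_mult flip: \<rho>_def)
  have "minors_sign_symmetric b {..<n}"
  proof -
    obtain t where t: "\<forall>i\<in>{..<n}. \<forall>j\<in>{..<n}. t i j * t i j = 1"
      and m: "\<forall>i\<in>{..<n}. \<forall>j\<in>{..<n}. \<forall>k\<in>{..<n}. \<forall>l\<in>{..<n}.
        0 \<le> t i j * t k l * minor2 (\<lambda>i j. A $$ (i, j)) i j k l"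
      using minors_sign_symmetric_second_compound[OF A assms(4)]
      unfolding minors_sign_symmetric_def by blast
    show ?thesis
    \<comment> \<open>The signature multiplies each minor by \<open>s i * s j * s k * s l\<close>;
      the signs of the pairs absorb these factors.\<close>
    proof (rule minors_sign_symmetricI[where s = "\<lambda>i j. t i j * (s i * s j)"])
      fix i j assume ij: "i \<in> {..<n}" "j \<in> {..<n}"
      have "t i j * (s i * s j) * (t i j * (s i * s j)) = (t i j * t i j) * (s i * s i) * (s j * s j)"
        by (simp only: mult_ac)
      then show "t i j * (s i * s j) * (t i j * (s i * s j)) = 1"
        using t[rule_format, OF ij] by (simp only: s mult_1)
      fix k l assume kl: "k \<in> {..<n}" "l \<in> {..<n}"
      have "t i j * (s i * s j) * (t k l * (s k * s l)) * minor2 b i j k l =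
        (s i * s i) * (s j * s j) * (s k * s k) * (s l * s l) *
        (t i j * t k l * minor2 (\<lambda>i j. A $$ (i, j)) i j k l) / (\<rho> * \<rho>)"
        using \<rho> by (simp add: b_def field_simps)
      also have "\<dots> = t i j * t k l * minor2 (\<lambda>i j. A $$ (i, j)) i j k l / (\<rho> * \<rho>)"
        by (simp only: s mult_1)
      also have "\<dots> \<ge> 0"
        using m[rule_format, OF ij kl] \<rho> by (intro divide_nonneg_pos) auto
      finally show "0 \<le> t i j * (s i * s j) * (t k l * (s k * s l)) * minor2 b i j k l" .
    qed
  qed
  moreover have "0 \<le> b i j" if "i < n" "j < n" for i j
    using sA[OF that] \<rho> by (simp add: b_def)
  ultimately obtain hs where odd: "\<forall>h\<in>set hs. odd h"
    and hs: "{#z \<in># fun_spec ?b [0..<n]. cmod z = 1#} = (\<Sum>h\<leftarrow>hs. mset_set {z. z ^ h = 1})"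
    using peripheral_fun_spec[of "[0..<n]" b] le_1 by (auto simp: atLeast0LessThan)
  have "peripheral_mset A = image_mset ((*) (complex_of_real \<rho>)) {#z \<in># fun_spec ?b [0..<n]. cmod z = 1#}"
    unfolding peripheral_mset_def \<rho>_def[symmetric] spec filter_mset_image_mset
    using \<rho> by (intro arg_cong2[where f = image_mset] filter_mset_cong refl) (auto simp: norm_mult)
  also have "\<dots> = (\<Sum>h\<leftarrow>hs. image_mset ((*) (complex_of_real \<rho>)) (mset_set {z. z ^ h = 1}))"
    unfolding hs by (induction hs) auto
  also have "\<dots> = (\<Sum>h\<leftarrow>hs. mset_set {z. z ^ h = complex_of_real \<rho> ^ h})"
  proof (intro arg_cong[where f = sum_list] map_cong refl)
    fix h
    have "{z. z ^ h = complex_of_real \<rho> ^ h} = (*) (complex_of_real \<rho>) ` {z. z ^ h = 1}"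
    proof safe
      fix z :: complex assume "z ^ h = complex_of_real \<rho> ^ h"
      then have "(z / complex_of_real \<rho>) ^ h = 1" "z = complex_of_real \<rho> * (z / complex_of_real \<rho>)"
        using \<rho> by (simp_all add: power_divide)
      then show "z \<in> (*) (complex_of_real \<rho>) ` {z. z ^ h = 1}" by blast
    qed (simp add: power_mult_distrib)
    then show "image_mset ((*) (complex_of_real \<rho>)) (mset_set {z. z ^ h = 1}) =
        mset_set {z. z ^ h = complex_of_real \<rho> ^ h}"
      using \<rho> by (simp add: image_mset_mset_set inj_on_def)
  qed
  finally have periph: "peripheral_mset A = (\<Sum>h\<leftarrow>hs. mset_set {z. z ^ h = complex_of_real \<rho> ^ h})" .
  \<comment> \<open>Every root set contains \<open>\<rho>\<close> exactly once, so the multiplicity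
    of \<open>\<rho>\<close> counts the sets.\<close>
  have "order \<rho> (char_poly A) = count (peripheral_mset A) (complex_of_real \<rho>)"
    using \<rho> by (simp add: order_char_poly_eq_count[OF A] peripheral_mset_def flip: \<rho>_def)
  also have "\<dots> = length hs"
    unfolding periph using odd \<rho>
  proof (induction hs)
    case (Cons h hs)
    \<comment> \<open>Oddness excludes \<open>h = 0\<close>, for which the set would be all complex
      numbers and \<open>mset_set\<close> would return the empty multiset.\<close>
    then have "finite {z. z ^ h = complex_of_real \<rho> ^ h}"
      by (intro finite_nth_roots) (auto elim: oddE)
    with Cons show ?case by simp
  qed simp
  finally have m: "order \<rho> (char_poly A) = length hs" .
  \<comment> \<open>The spectral radius is the modulus of some eigenvalue, so there is at least one
    set. Hence the multiplicity of \<open>\<rho>\<close> is positive, which also makes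
    \<open>\<rho>\<close> an eigenvalue.\<close>
  have "peripheral_mset A \<noteq> {#}"
  proof -
    obtain z where "z \<in># peripheral_mset A"
      using real_spectral_radius(1)[OF A] assms(1) by (auto simp: peripheral_mset_def)
    then show ?thesis by auto
  qed
  then have ne: "hs \<noteq> []"
    using periph by auto
  have "poly (char_poly A) \<rho> = 0"
    using m ne by (metis length_0_conv order_0I)
  then have eigenvalue: "eigenvalue A \<rho>"
    by (simp add: eigenvalue_root_char_poly[OF A])
  \<comment> \<open>The sets are numbered from 1 and list positions from 0, hence the shift.\<close>
  have "peripheral_mset A = (\<Sum>j=1..length hs. mset_set {z. z ^ (hs ! (j - 1)) = complex_of_real \<rho> ^ (hs ! (j - 1))})"
    unfolding periph sum_list_sum_nth
    by (rule sum.reindex_bij_witness[of _ "\<lambda>j. j - 1" Suc]) auto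
  moreover have "\<forall>j\<in>{1..length hs}. hs ! (j - 1) \<ge> 1 \<and> odd (hs ! (j - 1))"
  proof
    fix j assume "j \<in> {1..length hs}"
    then have "odd (hs ! (j - 1))"
      using odd by auto
    then show "hs ! (j - 1) \<ge> 1 \<and> odd (hs ! (j - 1))"
      by (cases "hs ! (j - 1)") auto
  qed
  ultimately have "\<exists>k. (\<forall>j\<in>{1..length hs}. k j \<ge> 1 \<and> odd (k j)) \<and>
      peripheral_mset A = (\<Sum>j=1..length hs. mset_set {z. z ^ k j = complex_of_real \<rho> ^ k j})"
    by (intro exI[of _ "\<lambda>j. hs ! (j - 1)"] conjI)
  moreover have "length hs \<ge> 1"
    using ne by (cases hs) auto
  ultimately show ?thesis
    using eigenvalue unfolding Let_def \<rho>_def[symmetric] m by blast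
qed

end
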